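(* Let $\mu$ and $\nu$ be two complex numbers such that $\Re\mu<2$ and $\Re\nu<0$. Then, for every complex number $z$, $$D_\nu(-z)D_{\nu+\mu-1}(z)=\frac{2^{1-\frac{\mu}{2}}}{\Gamma(-\nu)}\int_0^{+\infty}e^{(2\nu+\mu)t-\frac{z^2}{4}\tanh t}\,D_{\mu-1}\left(z\sqrt{\tanh t}\right)\frac{dt}{(\sinh 2t)^{\frac{\mu}{2}}}.$$
   Context: $D_\nu$ is the parabolic cylinder function, the entire function of $z\in\mathbb{C}$ (and of $\nu\in\mathbb{C}$) defined by $$D_\nu(z)=2^{\nu/2}e^{-z^2/4}\left(\frac{\sqrt{\pi}}{\Gamma(\frac12-\frac{\nu}{2})}\Phi\left(-\tfrac{\nu}{2},\tfrac12;\tfrac{z^2}{2}\right)-\frac{\sqrt{2\pi}\,z}{\Gamma(-\frac{\nu}{2})}\Phi\left(\tfrac12-\tfrac{\nu}{2},\tfrac32;\tfrac{z^2}{2}\right)\right),$$ with $1/\Gamma$ taken to be $0$ at the poles of $\Gamma$, where $\Phi(\nu,\mu;z)=\sum_{n=0}^{\infty}\frac{(\nu)_n}{(\mu)_n}\frac{z^n}{n!}$ is Kummer's confluent hypergeometric function and $(\nu)_n=\nu(\nu+1)\cdots(\nu+n-1)$. *)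

theory Defs
  imports "HOL-Analysis.Analysis"
begin

definition kummer_Phi :: "complex \<Rightarrow> complex \<Rightarrow> complex \<Rightarrow> complex" where
  "kummer_Phi a b z = (\<Sum>n. pochhammer a n / pochhammer b n * (z ^ n / fact n))"

(* The reciprocals of Gamma are written with rGamma, the entire function 1/Gamma,
   which vanishes at the poles of Gamma. *)
definition parabolic_D :: "complex \<Rightarrow> complex \<Rightarrow> complex" where
  "parabolic_D \<nu> z =
     2 powr (\<nu> / 2) * exp (- (z\<^sup>2 / 4)) *
       (of_real (sqrt pi) * rGamma (1 / 2 - \<nu> / 2) * kummer_Phi (- \<nu> / 2) (1 / 2) (z\<^sup>2 / 2)
        - of_real (sqrt (2 * pi)) * z * rGamma (- \<nu> / 2)
            * kummer_Phi (1 / 2 - \<nu> / 2) (3 / 2) (z\<^sup>2 / 2))"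

end

theory Submission
  imports Defs "HOL-Computational_Algebra.Formal_Power_Series"
begin

text \<open>
  Both sides are entire in \<open>z\<close>, and their Taylor coefficients at \<open>0\<close> agree. With
  \<open>d(a) = D\<^sub>a(0)\<close> one has
  \<open>exp (- z\<^sup>2/4) D\<^sub>a(z) = \<Sum>n. (-z)\<^sup>n/n! d(a+n)\<close> and
  \<open>exp (z\<^sup>2/4) D\<^sub>a(z) = \<Sum>n. (-z)\<^sup>n/n! (-a)\<^sub>n d(a-n)\<close>; the product of two such series gives the
  coefficients of the left-hand side. Integrating the first series term by term reduces the
  right-hand side to the moments of \<open>sqrt (tanh t)\<close>, which the substitution \<open>x = exp (-2t)\<close> turns into
  \<open>J(n,a,b) = \<integral> x\<^bsup>a-1\<^esup> (1-x)\<^sup>n (1-x\<^sup>2)\<^bsup>-b\<^esup> dx\<close> over \<open>(0,1)\<close>. For \<open>Re b < 1\<close> the binomial theorem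
  expresses \<open>J\<close> by Beta functions. The divergence of the individual Beta integrals for larger \<open>b\<close> is
  bypassed by an integration by parts relating \<open>b + 1\<close> to \<open>b\<close>, whose right-hand side counterpart is a
  contiguous relation for the finite sum. Legendre's duplication formula then matches the coefficients.
\<close>

subsection \<open>Taylor series of parabolic cylinder functions\<close>

text \<open>Quotient of consecutive terms of Kummer's series, for the ratio test. Divided by
  \<open>Suc n\<close>, each linear factor tends to 1, so \<open>z / Suc n\<close> decides the
  limit.\<close>

lemma kummer_Phi_ratio:
  "(\<lambda>n. norm ((a + of_nat n) / (b + of_nat n) * (z / of_nat (Suc n)))) \<longlonglongrightarrow> 0" for a b z :: complex
proof -
  have lim: "(\<lambda>n. c / of_nat (Suc n)) \<longlonglongrightarrow> 0" for c :: complex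
    using LIMSEQ_Suc[OF lim_const_over_n[of c]] by simp
  have q: "(\<lambda>n. (c + of_nat n) / of_nat (Suc n)) \<longlonglongrightarrow> 1" for c :: complex
  proof -
    have "(\<lambda>n. (c - 1) / of_nat (Suc n) + 1) \<longlonglongrightarrow> 0 + 1"
      by (intro tendsto_intros lim)
    moreover have "(c - 1) / of_nat (Suc n) + 1 = (c + of_nat n) / of_nat (Suc n)" for n
      by (simp add: field_simps del: of_nat_Suc) (simp add: algebra_simps)
    ultimately show ?thesis by simp
  qed
  have "(\<lambda>n. ((a + of_nat n) / of_nat (Suc n)) / ((b + of_nat n) / of_nat (Suc n)) * (z / of_nat (Suc n)))
          \<longlonglongrightarrow> 1 / 1 * 0"
    by (intro tendsto_intros q lim) auto
  then have "(\<lambda>n. (a + of_nat n) / (b + of_nat n) * (z / of_nat (Suc n))) \<longlonglongrightarrow> 0"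
    by (simp del: of_nat_Suc)
  from tendsto_norm[OF this] show ?thesis by simp
qed

lemma summable_norm_kummer_Phi:
  "summable (\<lambda>n. norm (pochhammer a n / pochhammer b n * (z ^ n / fact n)))" for a b z :: complex
proof -
  let ?f = "\<lambda>n. pochhammer a n / pochhammer b n * (z ^ n / fact n)"
  from order_tendstoD(2)[OF kummer_Phi_ratio[of a b z], of "1/2"]
  obtain N where N: "\<And>n. n \<ge> N \<Longrightarrow>
      norm ((a + of_nat n) / (b + of_nat n) * (z / of_nat (Suc n))) < 1/2"
    by (auto simp: eventually_sequentially)
  show ?thesis
  proof (rule summable_ratio_test[of "1/2" N])
    fix n assume n: "n \<ge> N"
    have "?f (Suc n) = ((a + of_nat n) / (b + of_nat n) * (z / of_nat (Suc n))) * ?f n"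
      by (simp add: pochhammer_Suc mult_ac)
    then have "norm (?f (Suc n)) = norm ((a + of_nat n) / (b + of_nat n) * (z / of_nat (Suc n))) * norm (?f n)"
      by (simp only: norm_mult)
    also have "\<dots> \<le> 1/2 * norm (?f n)"
      using N[OF n] by (intro mult_right_mono) auto
    finally show "norm (norm (?f (Suc n))) \<le> 1/2 * norm (norm (?f n))" by simp
  qed simp
qed

lemma kummer_Phi_sums:
  "(\<lambda>n. pochhammer a n / pochhammer b n * (z ^ n / fact n)) sums kummer_Phi a b z"
  unfolding kummer_Phi_def
  by (rule summable_sums) (rule summable_norm_cancel, rule summable_norm_kummer_Phi)

text \<open>Cauchy product of Kummer's series with the exponential series; each coefficient is a
  terminating hypergeometric sum at 1, evaluated by the Chu-Vandermonde identity.\<close>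

lemma kummer_transformation:
  assumes b: "b \<notin> \<int>\<^sub>\<le>\<^sub>0"
  shows "exp (- z) * kummer_Phi a b z = kummer_Phi (b - a) b (- z)"
proof -
  let ?f = "\<lambda>n. pochhammer a n / pochhammer b n * (z ^ n / fact n)"
  let ?g = "\<lambda>n. (- z) ^ n /\<^sub>R fact n"
  have "(\<lambda>n. \<Sum>i\<le>n. ?f i * ?g (n - i)) sums ((\<Sum>n. ?f n) * (\<Sum>n. ?g n))"
    using summable_norm_kummer_Phi[of a b z] summable_norm_exp[of "- z"]
    by (rule Cauchy_product_sums)
  also have "(\<Sum>n. ?f n) * (\<Sum>n. ?g n) = exp (- z) * kummer_Phi a b z"
    by (simp add: kummer_Phi_def exp_def mult.commute)
  also have "(\<lambda>n. \<Sum>i\<le>n. ?f i * ?g (n - i)) =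
             (\<lambda>n. pochhammer (b - a) n / pochhammer b n * ((- z) ^ n / fact n))"
  proof
    fix n
    have nz: "pochhammer b k \<noteq> 0" for k
      using b by (auto simp: pochhammer_eq_0_iff)
    have c: "\<forall>i\<in>{0..<n}. b \<noteq> - of_nat i"
      using b by auto
    \<comment> \<open>The factor \<open>1 / fact (n - i)\<close> and the sign left over from
      \<open>(- z) ^ (n - i)\<close> are absorbed into \<open>pochhammer (- of_nat n) i\<close>, as
      the Chu-Vandermonde sum requires.\<close>
    have "?f i * ?g (n - i) = ((- z) ^ n / fact n) *
            (pochhammer a i * pochhammer (- of_nat n) i / (fact i * pochhammer b i))" if "i \<le> n" for i
    proof -
      have "fact n = fact (n - i) * (pochhammer (of_nat n - of_nat i + 1) i :: complex)"
        using that pochhammer_product[of "n - i" n "1 :: complex"]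
        by (simp add: of_nat_diff add.commute flip: pochhammer_fact)
      then have 1: "pochhammer (- of_nat n) i = (- 1) ^ i * (fact n / fact (n - i) :: complex)"
        by (simp add: pochhammer_minus)
      have 2: "(- z) ^ n = (- 1) ^ i * z ^ i * (- z) ^ (n - i)"
        using that by (metis le_add_diff_inverse power_add power_minus)
      have 3: "(- 1) ^ i * (- 1) ^ i = (1 :: complex)"
        by (simp flip: power_mult_distrib)
      have gen: "s * w * y / fact n * (p * (s * (fact n / g)) / (f * q)) = (s * s) * (p / q * (w / f) * (y / g))"
        for s w y p g f q :: complex
        by (simp add: divide_inverse mult_ac)
      have "((- z) ^ n / fact n) * (pochhammer a i * pochhammer (- of_nat n) i / (fact i * pochhammer b i)) =
          ((- 1) ^ i * (- 1) ^ i) * (pochhammer a i / pochhammer b i * (z ^ i / fact i)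
            * ((- z) ^ (n - i) / fact (n - i)))"
        unfolding 1 2 by (rule gen)
      moreover have "?g (n - i) = (- z) ^ (n - i) / fact (n - i)"
        by (simp add: scaleR_conv_of_real divide_inverse mult.commute)
      ultimately show ?thesis by (simp only: 3 mult_1_left)
    qed
    then have "(\<Sum>i\<le>n. ?f i * ?g (n - i)) = ((- z) ^ n / fact n) *
       (\<Sum>i\<in>{0..n}. pochhammer a i * pochhammer (- of_nat n) i / (fact i * pochhammer b i))"
      by (simp add: sum_distrib_left atLeast0AtMost)
    then show "(\<Sum>i\<le>n. ?f i * ?g (n - i)) = pochhammer (b - a) n / pochhammer b n * ((- z) ^ n / fact n)"
      using Vandermonde_pochhammer[OF c, of a] by simp
  qed
  finally show ?thesis
    using kummer_Phi_sums[of "b - a" b "- z"] sums_unique2 by blast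
qed

section \<open>Values at the origin and the two Taylor series\<close>

text \<open>This is \<open>parabolic_D a 0\<close>, the d(a) of the opening text: at
  \<open>z = 0\<close> the odd part vanishes and the even Kummer series equals 1.\<close>

definition parabolic_D0 :: "complex \<Rightarrow> complex" where
  "parabolic_D0 a = 2 powr (a / 2) * of_real (sqrt pi) * rGamma (1 / 2 - a / 2)"

text \<open>Raising \<open>a\<close> by 2 lowers the argument of \<open>rGamma\<close> by 1. Through
  \<open>rGamma\<close> the relation also covers the poles of \<open>Gamma\<close>.\<close>

lemma parabolic_D0_add_2: "parabolic_D0 (a + 2) = - (a + 1) * parabolic_D0 a"
proof -
  have "rGamma (1 / 2 - (a + 2) / 2) = (1 / 2 - (a + 2) / 2) * rGamma (1 / 2 - (a + 2) / 2 + 1)"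
    by (rule rGamma_plus1[symmetric])
  also have "\<dots> = - ((a + 1) / 2) * rGamma (1 / 2 - a / 2)"
    by (simp add: field_simps)
  finally have 1: "rGamma (1 / 2 - (a + 2) / 2) = - ((a + 1) / 2) * rGamma (1 / 2 - a / 2)" .
  have 2: "(2 :: complex) powr ((a + 2) / 2) = 2 * 2 powr (a / 2)"
    by (simp add: add_divide_distrib powr_add)
  show ?thesis unfolding parabolic_D0_def 1 2 by (simp add: field_simps)
qed

lemma parabolic_D0_add_even:
  "parabolic_D0 (a + of_nat (2 * m)) = (- 2) ^ m * pochhammer (1 / 2 + a / 2) m * parabolic_D0 a"
proof (induction m)
  case (Suc m)
  have "parabolic_D0 (a + of_nat (2 * Suc m)) = - (a + of_nat (2 * m) + 1) * parabolic_D0 (a + of_nat (2 * m))"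
    using parabolic_D0_add_2[of "a + of_nat (2 * m)"] by (simp add: algebra_simps)
  also have "\<dots> = (- 2) ^ Suc m * pochhammer (1 / 2 + a / 2) (Suc m) * parabolic_D0 a"
    unfolding Suc by (simp add: pochhammer_Suc field_simps)
  finally show ?case .
qed simp

text \<open>Stepping down would divide by 1 - a, 3 - a, and so on. These factors are all contained
  in \<open>pochhammer (- a) (2 * m)\<close>, so the product form also holds at positive odd
  \<open>a\<close>.\<close>

lemma parabolic_D0_diff_even:
  "pochhammer (- a) (2 * m) * parabolic_D0 (a - of_nat (2 * m)) =
     2 ^ m * pochhammer (- a / 2) m * parabolic_D0 a"
proof (induction m)
  case (Suc m)
  have 1: "parabolic_D0 (a - of_nat (2 * m)) =
      (of_nat (2 * m) - a + 1) * parabolic_D0 (a - of_nat (2 * Suc m))"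
    using parabolic_D0_add_2[of "a - of_nat (2 * Suc m)"] by (simp add: algebra_simps)
  have "pochhammer (- a) (2 * Suc m) * parabolic_D0 (a - of_nat (2 * Suc m)) =
     (of_nat (2 * m) - a) * (pochhammer (- a) (2 * m) * parabolic_D0 (a - of_nat (2 * m)))"
    unfolding 1 by (simp add: pochhammer_Suc algebra_simps)
  also have "\<dots> = 2 ^ Suc m * pochhammer (- a / 2) (Suc m) * parabolic_D0 a"
    unfolding Suc by (simp add: pochhammer_Suc field_simps)
  finally show ?case .
qed simp

lemma fact_double_Suc:
  "(fact (Suc (2 * m)) :: complex) = 2 ^ (2 * m) * pochhammer (3 / 2) m * fact m"
proof -
  have "(1 / 2 :: complex) * pochhammer (3 / 2) m = pochhammer (1 / 2) m * (1 / 2 + of_nat m)"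
    using pochhammer_rec[of "1 / 2 :: complex" m] pochhammer_Suc[of "1 / 2 :: complex" m] by simp
  then have "pochhammer (3 / 2 :: complex) m = pochhammer (1 / 2) m * (1 + 2 * of_nat m)"
    by (simp add: field_simps)
  moreover have "(fact (Suc (2 * m)) :: complex) = (1 + 2 * of_nat m) * fact (2 * m)"
    by (simp add: fact_Suc)
  ultimately show ?thesis using fact_double[of m, where ?'a = complex] by (simp add: mult_ac)
qed

text \<open>The constant of the odd part is d(a + 1), because 1/2 - (a + 1)/2 = -a/2 and the extra
  \<open>sqrt 2\<close> is \<open>2 powr (1 / 2)\<close>.\<close>

lemma parabolic_D_conv_D0:
  "parabolic_D a z = exp (- (z\<^sup>2 / 4)) *
     (parabolic_D0 a * kummer_Phi (- a / 2) (1 / 2) (z\<^sup>2 / 2)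
      - parabolic_D0 (a + 1) * z * kummer_Phi (1 / 2 - a / 2) (3 / 2) (z\<^sup>2 / 2))"
proof -
  have "(2 :: complex) powr (1 / 2) = of_real (sqrt 2)"
    using powr_of_real[of 2 "1 / 2"] by (simp add: powr_half_sqrt)
  then have "(2 :: complex) powr ((a + 1) / 2) = 2 powr (a / 2) * of_real (sqrt 2)"
    by (simp add: add_divide_distrib powr_add)
  moreover have "1 / 2 - (a + 1) / 2 = - a / 2" by (simp add: field_simps)
  ultimately show ?thesis
    by (simp add: parabolic_D_def parabolic_D0_def real_sqrt_mult right_diff_distrib mult_ac)
qed

lemma sums_even_odd:
  fixes f :: "nat \<Rightarrow> complex"
  assumes "(\<lambda>m. f (2 * m)) sums s" "(\<lambda>m. f (Suc (2 * m))) sums t"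
  shows "f sums (s + t)"
proof -
  have "(\<lambda>n. if even n then f n else 0) sums s"
    using assms(1) by (subst sums_mono_reindex[of "\<lambda>m. 2 * m", symmetric])
      (auto simp: strict_mono_def elim!: evenE)
  moreover have "(\<lambda>n. if odd n then f n else 0) sums t"
    using assms(2) by (subst sums_mono_reindex[of "\<lambda>m. Suc (2 * m)", symmetric])
      (auto simp: strict_mono_def image_def elim!: oddE)
  ultimately have "(\<lambda>n. (if even n then f n else 0) + (if odd n then f n else 0)) sums (s + t)"
    by (rule sums_add)
  moreover have "(\<lambda>n. (if even n then f n else 0) + (if odd n then f n else 0)) = f" by auto
  ultimately show ?thesis by simp
qed

lemma half_not_nonpos_Ints: "(1 / 2 :: complex) \<notin> \<int>\<^sub>\<le>\<^sub>0" "(3 / 2 :: complex) \<notin> \<int>\<^sub>\<le>\<^sub>0"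
  by (auto elim!: nonpos_Ints_cases simp: complex_eq_iff)

lemma series_term_rearrange:
  "n / (t * p * f) * (q * r * d) = d * (r / p * ((q * n / t) / f))" for n :: complex
  by (simp add: divide_inverse mult_ac)

lemma series_term_rearrange':
  "- z * n / (t * p * f) * (q * r * d) = - (d * z) * (r / p * ((q * n / t) / f))" for n :: complex
  by (simp add: divide_inverse mult_ac)

text \<open>The factor \<open>exp (z\<^sup>2 / 4)\<close> cancels the exponential in the definition;
  the two remaining Kummer series in \<open>z\<^sup>2 / 2\<close> are the even and the odd
  terms.\<close>

lemma parabolic_D_exp_pos_sums:
  "(\<lambda>n. (- z) ^ n / fact n * (pochhammer (- a) n * parabolic_D0 (a - of_nat n)))
     sums (exp (z\<^sup>2 / 4) * parabolic_D a z)"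
proof -
  let ?f = "\<lambda>n. (- z) ^ n / fact n * (pochhammer (- a) n * parabolic_D0 (a - of_nat n))"
  have pw: "2 ^ m * (- z) ^ (2 * m) / 2 ^ (2 * m) = (z\<^sup>2 / 2) ^ m" for m
  proof -
    have "2 ^ m * (- z) ^ (2 * m) / 2 ^ (2 * m) = (2 * (- z)\<^sup>2 / 2\<^sup>2) ^ m"
      by (simp only: power_mult power_mult_distrib power_divide)
    then show ?thesis by simp
  qed
  have even: "?f (2 * m) = parabolic_D0 a * (pochhammer (- a / 2) m / pochhammer (1 / 2) m *
      ((z\<^sup>2 / 2) ^ m / fact m))" for m
    unfolding parabolic_D0_diff_even fact_double series_term_rearrange pw by (rule refl)
  have odd: "?f (Suc (2 * m)) = - (parabolic_D0 (a + 1) * z) *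
      (pochhammer (1 / 2 - a / 2) m / pochhammer (3 / 2) m * ((z\<^sup>2 / 2) ^ m / fact m))" for m
  proof -
    \<comment> \<open>Splitting off the first factor \<open>- a\<close> reduces the odd index for
      \<open>a\<close> to an even index for \<open>a - 1\<close>; then -a d(a - 1) = d(a +
      1).\<close>
    have "pochhammer (- a) (Suc (2 * m)) * parabolic_D0 (a - of_nat (Suc (2 * m))) =
      - a * (pochhammer (- (a - 1)) (2 * m) * parabolic_D0 (a - 1 - of_nat (2 * m)))"
      by (simp add: pochhammer_rec algebra_simps)
    also have "\<dots> = - a * (2 ^ m * pochhammer (- (a - 1) / 2) m * parabolic_D0 (a - 1))"
      by (simp only: parabolic_D0_diff_even)
    also have "\<dots> = 2 ^ m * pochhammer (1 / 2 - a / 2) m * parabolic_D0 (a + 1)"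
      using parabolic_D0_add_2[of "a - 1"] by (simp add: diff_divide_distrib add.commute)
    finally show ?thesis
      by (simp only: fact_double_Suc power_Suc series_term_rearrange' pw)
  qed
  have "exp (z\<^sup>2 / 4) * parabolic_D a z = parabolic_D0 a * kummer_Phi (- a / 2) (1 / 2) (z\<^sup>2 / 2)
      + - (parabolic_D0 (a + 1) * z) * kummer_Phi (1 / 2 - a / 2) (3 / 2) (z\<^sup>2 / 2)"
    unfolding parabolic_D_conv_D0 by (simp add: exp_minus)
  moreover have "?f sums \<dots>"
    by (intro sums_even_odd) (simp_all only: even odd sums_mult kummer_Phi_sums)
  ultimately show ?thesis by simp
qed

text \<open>Here the exponentials combine to \<open>exp (- (z\<^sup>2 / 2))\<close>. Kummer's
  transformation absorbs this factor, reversing the sign of the argument and changing the first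
  parameters to 1/2 + a/2 and 1 + a/2.\<close>

lemma parabolic_D_exp_neg_sums:
  "(\<lambda>n. (- z) ^ n / fact n * parabolic_D0 (a + of_nat n))
     sums (exp (- (z\<^sup>2 / 4)) * parabolic_D a z)"
proof -
  let ?f = "\<lambda>n. (- z) ^ n / fact n * parabolic_D0 (a + of_nat n)"
  have pw: "(- 2) ^ m * (- z) ^ (2 * m) / 2 ^ (2 * m) = (- (z\<^sup>2 / 2)) ^ m" for m
  proof -
    have "(- 2) ^ m * (- z) ^ (2 * m) / 2 ^ (2 * m) = (- 2 * (- z)\<^sup>2 / 2\<^sup>2) ^ m"
      by (simp only: power_mult power_mult_distrib power_divide)
    then show ?thesis by simp
  qed
  have even: "?f (2 * m) = parabolic_D0 a * (pochhammer (1 / 2 + a / 2) m / pochhammer (1 / 2) m *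
      ((- (z\<^sup>2 / 2)) ^ m / fact m))" for m
    unfolding parabolic_D0_add_even fact_double series_term_rearrange pw by (rule refl)
  have odd: "?f (Suc (2 * m)) = - (parabolic_D0 (a + 1) * z) *
      (pochhammer (1 + a / 2) m / pochhammer (3 / 2) m * ((- (z\<^sup>2 / 2)) ^ m / fact m))" for m
  proof -
    have "parabolic_D0 (a + of_nat (Suc (2 * m))) = (- 2) ^ m * pochhammer (1 + a / 2) m * parabolic_D0 (a + 1)"
      using parabolic_D0_add_even[of "a + 1" m] by (simp add: add_divide_distrib add_ac)
    then show ?thesis
      by (simp only: fact_double_Suc power_Suc series_term_rearrange' pw)
  qed
  have "exp (- (z\<^sup>2 / 4)) * parabolic_D a z =
     parabolic_D0 a * (exp (- (z\<^sup>2 / 2)) * kummer_Phi (- a / 2) (1 / 2) (z\<^sup>2 / 2))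
      + - (parabolic_D0 (a + 1) * z) * (exp (- (z\<^sup>2 / 2)) * kummer_Phi (1 / 2 - a / 2) (3 / 2) (z\<^sup>2 / 2))"
  proof -
    have "exp (- (z\<^sup>2 / 2)) = exp (- (z\<^sup>2 / 4)) * exp (- (z\<^sup>2 / 4))" by (simp flip: exp_add)
    then show ?thesis unfolding parabolic_D_conv_D0 by (simp add: algebra_simps)
  qed
  also have "\<dots> = parabolic_D0 a * kummer_Phi (1 / 2 + a / 2) (1 / 2) (- (z\<^sup>2 / 2))
      + - (parabolic_D0 (a + 1) * z) * kummer_Phi (1 + a / 2) (3 / 2) (- (z\<^sup>2 / 2))"
    using half_not_nonpos_Ints by (simp add: kummer_transformation)
  moreover have "?f sums \<dots>"
    by (intro sums_even_odd) (simp_all only: even odd sums_mult kummer_Phi_sums)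
  ultimately show ?thesis by simp
qed

text \<open>Convergence at the point \<open>norm z + 1\<close> gives absolute convergence at
  \<open>z\<close>, as needed for Cauchy products and for summation under the integral.\<close>

lemma summable_norm_powser:
  fixes c :: "nat \<Rightarrow> complex"
  assumes "\<And>z. summable (\<lambda>n. c n * z ^ n)"
  shows "summable (\<lambda>n. norm (c n * z ^ n))"
  by (rule powser_insidea[OF assms[of "of_real (norm z + 1)"]]) simp

subsection \<open>Beta integrals\<close>

text \<open>A function continuous on an open set and cut off outside it is Borel measurable, so
  \<open>lborel\<close> and its completion agree on its integrability.\<close>

lemma set_integrable_lborel_iff_lebesgue:
  fixes f :: "real \<Rightarrow> 'a :: euclidean_space"
  assumes "open S" "continuous_on S f"
  shows "set_integrable lborel S f \<longleftrightarrow> f absolutely_integrable_on S"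
proof -
  have "(\<lambda>x. indicator S x *\<^sub>R f x) \<in> borel_measurable lborel"
    using borel_measurable_continuous_on_indicator[of S f] assms by simp
  then show ?thesis unfolding set_integrable_def by (rule integrable_completion[symmetric])
qed

lemma set_lborel_integral_substitution:
  fixes f :: "real \<Rightarrow> 'a :: euclidean_space"
  assumes S: "open S" and T: "open (g ` S)" and inj: "inj_on g S"
    and g: "\<And>x. x \<in> S \<Longrightarrow> (g has_field_derivative h x) (at x)"
    and h: "continuous_on S h" and f: "continuous_on (g ` S) f"
  shows "set_integrable lborel S (\<lambda>x. \<bar>h x\<bar> *\<^sub>R f (g x)) \<longleftrightarrow> set_integrable lborel (g ` S) f"
    and "(LINT x:S|lborel. \<bar>h x\<bar> *\<^sub>R f (g x)) = (LINT x:g ` S|lborel. f x)"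
proof -
  have g': "\<And>x. x \<in> S \<Longrightarrow> (g has_field_derivative h x) (at x within S)"
    by (rule has_field_derivative_at_within) (rule g)
  have "continuous_on S g"
    by (intro continuous_at_imp_continuous_on ballI) (metis DERIV_isCont g)
  then have fg: "continuous_on S (\<lambda>x. \<bar>h x\<bar> *\<^sub>R f (g x))"
    using f by (intro continuous_intros h continuous_on_compose2[OF f]) auto
  have S': "S \<in> sets lebesgue" using S by auto
  note cov = has_absolute_integral_change_of_variables_real[OF S' g' inj, of f]
  note iff = set_integrable_lborel_iff_lebesgue[OF S fg] set_integrable_lborel_iff_lebesgue[OF T f]
  show *: "set_integrable lborel S (\<lambda>x. \<bar>h x\<bar> *\<^sub>R f (g x)) \<longleftrightarrow> set_integrable lborel (g ` S) f"
    unfolding iff using cov by blast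
  show "(LINT x:S|lborel. \<bar>h x\<bar> *\<^sub>R f (g x)) = (LINT x:g ` S|lborel. f x)"
  proof (cases "set_integrable lborel (g ` S) f")
    case True
    then show ?thesis using * cov set_borel_integral_eq_integral(2) iff by metis
  next
    case False
    \<comment> \<open>Neither side is integrable, so both integrals have the default value
      0.\<close>
    then show ?thesis using * unfolding set_integrable_def set_lebesgue_integral_def
      by (simp add: not_integrable_integral_eq)
  qed
qed

section \<open>Euler's Beta integral for complex parameters\<close>

lemma of_real_powr_eq_exp: "x > 0 \<Longrightarrow> of_real x powr c = exp (c * of_real (ln x))" for c :: complex
  by (simp add: powr_def Ln_of_real)

text \<open>
  Complex powers of positive reals are written with \<open>exp\<close> and the real \<open>ln\<close>, which makes
  measurability, continuity and differentiation immediate.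
\<close>

definition Gamma_kernel :: "complex \<Rightarrow> real \<Rightarrow> complex" where
  "Gamma_kernel c x = indicator {0<..} x *\<^sub>R exp ((c - 1) * of_real (ln x) - of_real x)"

lemma Gamma_kernel_measurable [measurable]: "Gamma_kernel c \<in> borel_measurable borel"
  unfolding Gamma_kernel_def[abs_def] by measurable

lemma Gamma_kernel_integral:
  assumes "Re c > 0"
  shows "integrable lborel (Gamma_kernel c)" "(LINT x|lborel. Gamma_kernel c x) = Gamma c"
proof -
  let ?f = "\<lambda>x. exp ((c - 1) * of_real (ln x) - of_real x)"
  have eq: "complex_of_real x powr (c - 1) / of_real (exp x) = ?f x" if "x \<in> {0<..}" for x
    using that by (simp add: of_real_powr_eq_exp exp_diff exp_of_real)
  have "?f absolutely_integrable_on {0<..}"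
    using absolutely_integrable_Gamma_integral'[OF assms]
    by (subst (asm) set_integrable_cong[OF refl refl eq]) auto
  moreover have "continuous_on {0<..} ?f" by (auto intro!: continuous_intros)
  ultimately have int: "set_integrable lborel {0<..} ?f"
    by (subst set_integrable_lborel_iff_lebesgue) auto
  show "integrable lborel (Gamma_kernel c)"
    using int unfolding set_integrable_def Gamma_kernel_def[abs_def] .
  have "(?f has_integral Gamma c) {0<..}"
    using Gamma_integral_complex'[OF assms] by (subst (asm) has_integral_cong[OF eq])
  then show "(LINT x|lborel. Gamma_kernel c x) = Gamma c"
    using set_borel_integral_eq_integral(2)[OF int] unfolding set_lebesgue_integral_def Gamma_kernel_def[abs_def]
    by (simp add: integral_unique)
qed

text \<open>After the scaling s = v x the powers of \<open>v\<close>, Jacobian included, combine to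
  the exponent a + b - 1 and the exponentials to exp (-v). For \<open>x\<close> outside (0,1) one
  kernel argument is not positive and both sides vanish.\<close>

lemma Gamma_kernel_scale:
  assumes "v > 0"
  shows "of_real v * (Gamma_kernel a (v * x) * Gamma_kernel b (v - v * x)) =
    Gamma_kernel (a + b) v *
      (indicator {0<..<1} x *\<^sub>R exp ((a - 1) * of_real (ln x) + (b - 1) * of_real (ln (1 - x))))"
proof (cases "x \<in> {0<..<1}")
  case True
  then have x: "0 < x" "x < 1" by auto
  have 1: "ln (v * x) = ln v + ln x" "ln (v - v * x) = ln v + ln (1 - x)"
    using assms x by (simp_all add: ln_mult right_diff_distrib[of v 1 x, simplified, symmetric])
  have 2: "0 < v * x" "0 < v - v * x" using assms x by auto
  have "complex_of_real v = exp (of_real (ln v))" using assms by (simp add: exp_of_real)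
  then have "of_real v * (Gamma_kernel a (v * x) * Gamma_kernel b (v - v * x)) =
     exp (of_real (ln v) + (((a - 1) * of_real (ln (v * x)) - of_real (v * x))
       + ((b - 1) * of_real (ln (v - v * x)) - of_real (v - v * x))))"
    using 2 unfolding Gamma_kernel_def exp_add by simp
  also have "of_real (ln v) + (((a - 1) * of_real (ln (v * x)) - of_real (v * x))
       + ((b - 1) * of_real (ln (v - v * x)) - of_real (v - v * x))) =
       ((a + b - 1) * of_real (ln v) - of_real v) + ((a - 1) * of_real (ln x) + (b - 1) * of_real (ln (1 - x)))"
    unfolding 1 by (simp add: algebra_simps)
  finally show ?thesis using x assms unfolding Gamma_kernel_def exp_add by simp
next
  case False
  then have "v * x \<le> 0 \<or> v - v * x \<le> 0" using assms
    by (auto simp: mult_le_0_iff not_less)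
  then show ?thesis using False by (auto simp: Gamma_kernel_def)
qed

text \<open>By Fubini the convolution of two Gamma kernels has total integral
  \<open>Gamma a * Gamma b\<close>; by scaling it is \<open>Gamma_kernel (a + b)\<close> times the
  integral sought. It remains to divide by \<open>Gamma (a + b)\<close>, which is not 0.\<close>

lemma complex_Beta_integral:
  assumes a: "Re a > 0" and b: "Re b > 0"
  shows "(LINT x:{0<..<1}|lborel. exp ((a - 1) * of_real (ln x) + (b - 1) * of_real (ln (1 - x)))) = Beta a b"
    (is "?B = _")
proof -
  let ?h = "\<lambda>(s, v). Gamma_kernel a s * Gamma_kernel b (v - s)"
  have shift: "integrable lborel (\<lambda>v. Gamma_kernel b (v - s))"
    "(LINT v|lborel. Gamma_kernel b (v - s)) = Gamma b"
    "(LINT v|lborel. norm (Gamma_kernel b (v - s))) = (LINT v|lborel. norm (Gamma_kernel b v))" for s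
    using lborel_integrable_real_affine_iff[of 1 "Gamma_kernel b" "- s"]
      lborel_integral_real_affine[of 1 "Gamma_kernel b" "- s"]
      lborel_integral_real_affine[of 1 "\<lambda>v. norm (Gamma_kernel b v)" "- s"]
      Gamma_kernel_integral[OF b] by simp_all
  have int: "integrable (lborel \<Otimes>\<^sub>M lborel) ?h"
  proof (rule lborel_pair.Fubini_integrable)
    show "?h \<in> borel_measurable (lborel \<Otimes>\<^sub>M lborel)" by measurable
    have "integrable lborel (\<lambda>s. norm (Gamma_kernel a s) * (LINT v|lborel. norm (Gamma_kernel b v)))"
      using Gamma_kernel_integral(1)[OF a] by simp
    then show "integrable lborel (\<lambda>s. LINT v|lborel. norm (?h (s, v)))"
      by (simp add: norm_mult shift)
    show "AE s in lborel. integrable lborel (\<lambda>v. ?h (s, v))"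
      using shift(1) by simp
  qed
  have "Gamma a * Gamma b = (LINT s|lborel. LINT v|lborel. Gamma_kernel a s * Gamma_kernel b (v - s))"
    using Gamma_kernel_integral[OF a] by (simp add: shift)
  also have "\<dots> = (LINT v|lborel. LINT s|lborel. Gamma_kernel a s * Gamma_kernel b (v - s))"
    using lborel_pair.Fubini_integral[OF int] by simp
  also have "\<dots> = (LINT v|lborel. Gamma_kernel (a + b) v * ?B)"
  proof (rule Bochner_Integration.integral_cong[OF refl])
    fix v :: real
    show "(LINT s|lborel. Gamma_kernel a s * Gamma_kernel b (v - s)) = Gamma_kernel (a + b) v * ?B"
    proof (cases "v > 0")
      case True
      then have "(LINT s|lborel. Gamma_kernel a s * Gamma_kernel b (v - s)) =
          (LINT x|lborel. of_real v * (Gamma_kernel a (v * x) * Gamma_kernel b (v - v * x)))"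
        using lborel_integral_real_affine[of v "\<lambda>s. Gamma_kernel a s * Gamma_kernel b (v - s)" 0]
        by (simp add: scaleR_conv_of_real)
      also have "\<dots> = Gamma_kernel (a + b) v * ?B"
        unfolding Gamma_kernel_scale[OF True] set_lebesgue_integral_def
        by (simp only: integral_mult_right_zero)
      finally show ?thesis .
    next
      case False
      then have "Gamma_kernel a s * Gamma_kernel b (v - s) = 0" for s
        by (auto simp: Gamma_kernel_def indicator_def)
      moreover have "Gamma_kernel (a + b) v = 0" using False by (simp add: Gamma_kernel_def)
      ultimately show ?thesis by (simp only: Bochner_Integration.integral_zero mult_zero_left)
    qed
  qed
  also have "\<dots> = Gamma (a + b) * ?B"
    using Gamma_kernel_integral[of "a + b"] a b by simp
  finally have "Gamma a * Gamma b = Gamma (a + b) * ?B" .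
  moreover have "a + b \<notin> \<int>\<^sub>\<le>\<^sub>0" using a b by (auto elim!: nonpos_Ints_cases dest!: arg_cong[where f = Re])
  ultimately show ?thesis by (simp add: Beta_def Gamma_eq_zero_iff)
qed

section \<open>The integral J(n,a,b) and its recurrence in b\<close>

text \<open>Integrand of J(n,a,b): the exponential stands for x^(a-1) (1-x^2)^(-b).\<close>

definition beta_integrand :: "nat \<Rightarrow> complex \<Rightarrow> complex \<Rightarrow> real \<Rightarrow> complex" where
  "beta_integrand n a b x = exp ((a - 1) * of_real (ln x) - b * of_real (ln (1 - x\<^sup>2))) * of_real ((1 - x) ^ n)"

lemma one_minus_square_pos: "0 < x \<Longrightarrow> x < 1 \<Longrightarrow> 0 < 1 - x\<^sup>2" for x :: real
  by (simp add: power_less_one_iff)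

lemma continuous_on_beta_integrand: "continuous_on {0<..<1} (beta_integrand n a b)"
  unfolding beta_integrand_def[abs_def]
  by (intro continuous_intros) (use one_minus_square_pos in force)+

text \<open>Factoring 1 - x^2 = (1 - x)(1 + x) exposes the exponent n - Re b at the endpoint 1, the
  source of the condition \<open>Re b < real n + 1\<close>.\<close>

lemma norm_beta_integrand:
  assumes x: "0 < x" "x < 1"
  shows "norm (beta_integrand n a b x) = x powr (Re a - 1) * (1 - x) powr (real n - Re b) * (1 + x) powr (- Re b)"
proof -
  have ln: "ln (1 - x\<^sup>2) = ln (1 - x) + ln (1 + x)"
    using x by (subst ln_mult_pos[symmetric]) (auto simp: algebra_simps power2_eq_square)
  have "norm (beta_integrand n a b x) = exp ((Re a - 1) * ln x - Re b * ln (1 - x\<^sup>2)) * (1 - x) powr real n"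
    using x by (simp add: beta_integrand_def norm_mult powr_realpow del: of_real_power of_real_diff)
  also have "\<dots> = x powr (Re a - 1) * (1 - x) powr (real n - Re b) * (1 + x) powr (- Re b)"
    unfolding ln using x by (simp add: powr_def algebra_simps flip: exp_add)
  finally show ?thesis .
qed

lemma set_integrable_beta_integrand:
  assumes a: "Re a > 0" and b: "Re b < real n + 1"
  shows "set_integrable lborel {0<..<1} (beta_integrand n a b)"
  unfolding set_integrable_def
proof (rule Bochner_Integration.integrable_bound[OF _ _ AE_I2])
  \<comment> \<open>Bounds \<open>(1 + x) powr (- Re b)\<close> on (0,1): by
    \<open>2 powr (- Re b)\<close> if \<open>Re b \<le> 0\<close>, by 1 otherwise.\<close>
  define C where "C = max 1 (2 powr (- Re b))"
  have "set_integrable lborel {0..1} (\<lambda>x. x powr (Re a - 1) * (1 - x) powr (real n - Re b))"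
    using integrable_Beta[of "Re a" "real n - Re b + 1"] a b by simp
  then show "integrable lborel (\<lambda>x. C * (indicator {0..1} x *\<^sub>R (x powr (Re a - 1) * (1 - x) powr (real n - Re b))))"
    unfolding set_integrable_def by simp
  show "(\<lambda>x. indicator {0<..<1} x *\<^sub>R beta_integrand n a b x) \<in> borel_measurable lborel"
    using borel_measurable_continuous_on_indicator[OF _ continuous_on_beta_integrand] by simp
  fix x :: real
  show "norm (indicator {0<..<1} x *\<^sub>R beta_integrand n a b x) \<le>
    norm (C * (indicator {0..1} x *\<^sub>R (x powr (Re a - 1) * (1 - x) powr (real n - Re b))))"
  proof (cases "x \<in> {0<..<1}")
    case True
    have "(1 + x) powr (- Re b) \<le> C"
    proof (cases "Re b \<le> 0")
      case True
      then show ?thesis using \<open>x \<in> {0<..<1}\<close> unfolding C_def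
        by (intro max.coboundedI2 powr_mono2) auto
    next
      case False
      then show ?thesis using \<open>x \<in> {0<..<1}\<close> powr_mono[of "- Re b" 0 "1 + x"] unfolding C_def
        by (intro max.coboundedI1) auto
    qed
    then have "x powr (Re a - 1) * (1 - x) powr (real n - Re b) * (1 + x) powr (- Re b)
       \<le> x powr (Re a - 1) * (1 - x) powr (real n - Re b) * C"
      by (intro mult_left_mono) auto
    moreover have "C \<ge> 0" unfolding C_def by simp
    ultimately show ?thesis using True by (simp add: norm_beta_integrand abs_mult mult_ac)
  qed auto
qed

definition beta_integral :: "nat \<Rightarrow> complex \<Rightarrow> complex \<Rightarrow> complex" where
  "beta_integral n a b = (LINT x:{0<..<1}|lborel. beta_integrand n a b x)"

text \<open>The substitution y = x^2 gives half of Euler's Beta integral with parameters a/2 and 1 -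
  b.\<close>

lemma beta_integral_0:
  assumes a: "Re a > 0" and b: "Re b < 1"
  shows "beta_integral 0 a b = Beta (a / 2) (1 - b) / 2"
proof -
  let ?f = "\<lambda>x. exp ((a / 2 - 1) * of_real (ln x) + ((1 - b) - 1) * of_real (ln (1 - x)))"
  have img: "(\<lambda>x. x\<^sup>2) ` {0<..<1} = {0<..<1 :: real}"
  proof safe
    fix y :: real assume "y \<in> {0<..<1}"
    then show "y \<in> (\<lambda>x. x\<^sup>2) ` {0<..<1}"
      by (intro image_eqI[of _ _ "sqrt y"]) auto
  qed (auto simp: power_less_one_iff)
  have "(LINT x:{0<..<1}|lborel. \<bar>2 * x\<bar> *\<^sub>R ?f (x\<^sup>2)) = (LINT x:(\<lambda>x. x\<^sup>2) ` {0<..<1}|lborel. ?f x)"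
  proof (rule set_lborel_integral_substitution)
    show "inj_on (\<lambda>x. x\<^sup>2) {0<..<1::real}" by (auto intro!: inj_onI simp: power2_eq_iff)
    show "continuous_on ((\<lambda>x. x\<^sup>2) ` {0<..<1}) ?f"
      unfolding img by (intro continuous_intros) auto
    show "((\<lambda>x. x\<^sup>2) has_real_derivative 2 * x) (at x)" for x
      by (auto intro!: derivative_eq_intros)
  qed (auto intro!: continuous_intros simp: img)
  also have "\<dots> = Beta (a / 2) (1 - b)"
    unfolding img using a b by (intro complex_Beta_integral) auto
  also have "(LINT x:{0<..<1}|lborel. \<bar>2 * x\<bar> *\<^sub>R ?f (x\<^sup>2)) = (LINT x:{0<..<1}|lborel. 2 * beta_integrand 0 a b x)"
  proof (rule set_lebesgue_integral_cong; safe?)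
    fix x :: real assume x: "x \<in> {0<..<1}"
    have "\<bar>2 * x\<bar> *\<^sub>R ?f (x\<^sup>2) = 2 * (exp (of_real (ln x)) * ?f (x\<^sup>2))"
      using x by (simp add: scaleR_conv_of_real exp_of_real)
    also have "\<dots> = 2 * beta_integrand 0 a b x"
      using x unfolding exp_add[symmetric] beta_integrand_def
      by (simp add: ln_realpow algebra_simps)
    finally show "\<bar>2 * x\<bar> *\<^sub>R ?f (x\<^sup>2) = 2 * beta_integrand 0 a b x" .
  qed auto
  finally show ?thesis by (simp add: beta_integral_def mult.commute)
qed

text \<open>Binomial expansion of (1 - x)^n, where x^k shifts \<open>a\<close> by k. The condition
  \<open>Re b < 1\<close> makes each term integrable by itself.\<close>

lemma beta_integral_expand:
  assumes a: "Re a > 0" and b: "Re b < 1"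
  shows "beta_integral n a b = (\<Sum>k\<le>n. of_nat (n choose k) * (- 1) ^ k * beta_integral 0 (a + of_nat k) b)"
proof -
  have "beta_integral n a b = (LINT x:{0<..<1}|lborel.
      (\<Sum>k\<le>n. (of_nat (n choose k) * (- 1) ^ k) * beta_integrand 0 (a + of_nat k) b x))"
    unfolding beta_integral_def
  proof (rule set_lebesgue_integral_cong; safe?)
    fix x :: real assume x: "x \<in> {0<..<1}"
    have pw: "complex_of_real x ^ k = exp (of_nat k * of_real (ln x))" for k
      using x by (simp add: exp_of_nat_mult exp_of_real)
    have "complex_of_real ((1 - x) ^ n) = (- of_real x + 1) ^ n" by simp
    also have "\<dots> = (\<Sum>k\<le>n. of_nat (n choose k) * (- 1) ^ k * exp (of_nat k * of_real (ln x)))"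
      unfolding binomial_ring by (simp add: power_minus[of "of_real x"] pw mult_ac)
    finally show "beta_integrand n a b x =
        (\<Sum>k\<le>n. (of_nat (n choose k) * (- 1) ^ k) * beta_integrand 0 (a + of_nat k) b x)"
      unfolding beta_integrand_def
      by (simp add: sum_distrib_left sum_divide_distrib algebra_simps exp_add exp_diff)
  qed auto
  also have "\<dots> = (\<Sum>k\<le>n. (of_nat (n choose k) * (- 1) ^ k) * beta_integral 0 (a + of_nat k) b)"
  proof -
    have "integrable lborel (\<lambda>x. indicator {0<..<1} x *\<^sub>R ((of_nat (n choose k) * (- 1) ^ k) * beta_integrand 0 (a + of_nat k) b x))" for k
      using set_integrable_mult_right[OF set_integrable_beta_integrand[of "a + of_nat k" b 0]] a b
      unfolding set_integrable_def by simp
    then show ?thesis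
      unfolding beta_integral_def set_integral_mult_right[symmetric]
      unfolding set_lebesgue_integral_def scaleR_sum_right
      by (intro Bochner_Integration.integral_sum)
  qed
  finally show ?thesis .
qed

text \<open>Integration of the derivative of x^a (1-x)^(n+1) (1-x^2)^(-b) over (0,1). The boundary
  values vanish because Re a and n + 1 - Re b are positive.\<close>

lemma beta_integral_rec:
  assumes a: "Re a > 0" and b: "Re b < real n + 1"
  shows "2 * b * beta_integral (Suc n) a (b + 1) =
    (2 * b - a) * beta_integral (Suc n) a b + of_nat (Suc n) * beta_integral n (a + 1) b"
proof -
  let ?F = "beta_integrand (Suc n) (a + 1) b"
  let ?f = "\<lambda>x. (a - 2 * b) * beta_integrand (Suc n) a b x + 2 * b * beta_integrand (Suc n) a (b + 1) x
    - of_nat (Suc n) * beta_integrand n (a + 1) b x"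
  have int: "set_integrable lborel {0<..<1} (beta_integrand (Suc n) a b)"
    "set_integrable lborel {0<..<1} (beta_integrand (Suc n) a (b + 1))"
    "set_integrable lborel {0<..<1} (beta_integrand n (a + 1) b)"
    using a b by (auto intro!: set_integrable_beta_integrand)
  have f: "set_integrable lborel {0<..<1} ?f"
    by (intro set_integral_diff set_integral_add set_integrable_mult_right int)
  have nF: "norm (?F x) = x powr Re a * (1 - x) powr (real (Suc n) - Re b) * (1 + x) powr (- Re b)"
    if "0 < x" "x < 1" for x
    using norm_beta_integrand[OF that, of "Suc n" "a + 1" b] by simp
  have lim0: "(?F \<longlongrightarrow> 0) (at_right 0)"
  proof (rule tendsto_norm_zero_cancel)
    have "((\<lambda>x. x powr Re a * (1 - x) powr (real (Suc n) - Re b) * (1 + x) powr (- Re b)) \<longlongrightarrow>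
        0 powr Re a * (1 - 0) powr (real (Suc n) - Re b) * (1 + 0) powr (- Re b)) (at_right 0)"
      using a by (intro tendsto_intros tendsto_powr') (auto simp: eventually_at_filter)
    then have "((\<lambda>x. x powr Re a * (1 - x) powr (real (Suc n) - Re b) * (1 + x) powr (- Re b)) \<longlongrightarrow> 0) (at_right 0)"
      by simp
    then show "((\<lambda>x. norm (?F x)) \<longlongrightarrow> 0) (at_right 0)"
      by (rule Lim_transform_eventually)
         (use eventually_at_right_less[of 0] eventually_at_right_real[of 0 1] nF in \<open>auto elim!: eventually_mono\<close>)
  qed
  have lim1: "(?F \<longlongrightarrow> 0) (at_left 1)"
  proof (rule tendsto_norm_zero_cancel)
    have "((\<lambda>x. x powr Re a * (1 - x) powr (real (Suc n) - Re b) * (1 + x) powr (- Re b)) \<longlongrightarrow>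
        1 powr Re a * (1 - 1) powr (real (Suc n) - Re b) * (1 + 1) powr (- Re b)) (at_left 1)"
      using b by (intro tendsto_intros tendsto_powr') (auto simp: eventually_at_filter)
    then have "((\<lambda>x. x powr Re a * (1 - x) powr (real (Suc n) - Re b) * (1 + x) powr (- Re b)) \<longlongrightarrow> 0) (at_left 1)"
      by simp
    then show "((\<lambda>x. norm (?F x)) \<longlongrightarrow> 0) (at_left 1)"
      by (rule Lim_transform_eventually)
         (use eventually_at_left_real[of 0 1] nF in \<open>auto elim!: eventually_mono\<close>)
  qed
  have deriv: "(?F has_vector_derivative ?f x) (at x)" if x: "0 < x" "x < 1" for x
  proof -
    have pos: "0 < 1 - x\<^sup>2" using one_minus_square_pos x by blast
    \<comment> \<open>Common factor of all three integrands; relative to it the derivative formula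
      becomes an identity between rational expressions in x and 1 - x^2.\<close>
    define E where "E = exp ((a - 1) * of_real (ln x) - b * of_real (ln (1 - x\<^sup>2)))"
    have E1: "exp (a * of_real (ln x) - b * of_real (ln (1 - x\<^sup>2))) = of_real x * E"
      using x unfolding E_def by (simp add: algebra_simps exp_add exp_diff exp_of_real)
    have E2: "exp ((a - 1) * of_real (ln x) - (b + 1) * of_real (ln (1 - x\<^sup>2))) = E / of_real (1 - x\<^sup>2)"
      using pos unfolding E_def by (simp add: algebra_simps exp_add exp_diff exp_of_real)
    have "((\<lambda>x. a * of_real (ln x) - b * of_real (ln (1 - x\<^sup>2))) has_vector_derivative
        (a * of_real (1 / x) - b * of_real (- (2 * x) / (1 - x\<^sup>2)))) (at x)"
      using x pos by (auto intro!: derivative_eq_intros has_vector_derivative_mult_right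
         has_vector_derivative_of_real has_vector_derivative_diff)
    note field_vector_diff_chain_at[OF this DERIV_exp]
    then have "((\<lambda>x. exp (a * of_real (ln x) - b * of_real (ln (1 - x\<^sup>2)))) has_vector_derivative
        (a * of_real (1 / x) - b * of_real (- (2 * x) / (1 - x\<^sup>2))) * (of_real x * E)) (at x)"
      by (simp add: o_def E1)
    moreover have "((\<lambda>x. complex_of_real ((1 - x) ^ Suc n)) has_vector_derivative
        of_real (- (real (Suc n) * (1 - x) ^ n))) (at x)"
    proof (intro has_vector_derivative_of_real)
      have "((\<lambda>x. 1 - x) has_real_derivative - 1) (at x)" by (auto intro!: derivative_eq_intros)
      from DERIV_power[OF this, of "Suc n"]
      show "((\<lambda>x. (1 - x) ^ Suc n) has_real_derivative - (real (Suc n) * (1 - x) ^ n)) (at x)"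
        by simp
    qed
    ultimately have "((\<lambda>x. exp (a * of_real (ln x) - b * of_real (ln (1 - x\<^sup>2))) * complex_of_real ((1 - x) ^ Suc n))
       has_vector_derivative (of_real x * E * of_real (- (real (Suc n) * (1 - x) ^ n)) +
        (a * of_real (1 / x) - b * of_real (- (2 * x) / (1 - x\<^sup>2))) * (of_real x * E) * of_real ((1 - x) ^ Suc n))) (at x)"
      unfolding E1[symmetric] by (rule has_vector_derivative_mult)
    moreover have "(of_real x * E * of_real (- (real (Suc n) * (1 - x) ^ n)) +
        (a * of_real (1 / x) - b * of_real (- (2 * x) / (1 - x\<^sup>2))) * (of_real x * E) * of_real ((1 - x) ^ Suc n)) = ?f x"
    proof -
      define P Q X d where "P = complex_of_real ((1 - x) ^ Suc n)" and "Q = complex_of_real ((1 - x) ^ n)"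
        and "X = complex_of_real x" and "d = complex_of_real (1 - x\<^sup>2)"
      have X: "X \<noteq> 0" "d \<noteq> 0" "X\<^sup>2 = 1 - d"
      proof -
        show "X \<noteq> 0" using x by (simp add: X_def)
        show "d \<noteq> 0" unfolding d_def of_real_eq_0_iff using pos by linarith
        show "X\<^sup>2 = 1 - d" by (simp add: X_def d_def)
      qed
      have f: "beta_integrand (Suc n) a b x = E * P" "beta_integrand (Suc n) a (b + 1) x = E / d * P"
        "beta_integrand n (a + 1) b x = X * E * Q"
        unfolding beta_integrand_def add_diff_cancel_right' E1 E2 unfolding E_def X_def P_def Q_def d_def
        by (rule refl)+
      have "of_real x * E * of_real (- (real (Suc n) * (1 - x) ^ n)) +
        (a * of_real (1 / x) - b * of_real (- (2 * x) / (1 - x\<^sup>2))) * (of_real x * E) * of_real ((1 - x) ^ Suc n)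
        = X * E * (- (of_nat (Suc n) * Q)) + (a * (1 / X) - b * (- (2 * X) / d)) * (X * E) * P"
      proof -
        have "of_real (- (real (Suc n) * (1 - x) ^ n)) = - (of_nat (Suc n) * Q)"
          unfolding Q_def of_real_minus of_real_mult by (simp only: of_real_of_nat_eq)
        moreover have "of_real (1 / x) = 1 / X"
          by (simp add: X_def)
        moreover have "of_real (- (2 * x) / (1 - x\<^sup>2)) = - (2 * X) / d"
          unfolding d_def X_def of_real_divide by simp
        ultimately show ?thesis by (simp only: flip: X_def P_def)
      qed
      also have "(a * (1 / X) - b * (- (2 * X) / d)) * (X * E) * P = a * (E * P) + 2 * b * (X\<^sup>2 / d) * (E * P)"
        using X(1,2) by (simp add: field_simps power2_eq_square)
      \<comment> \<open>Differentiating (1-x^2)^(-b) leaves x^2/(1-x^2); this splits it into the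
        contributions of parameters \<open>b + 1\<close> and \<open>b\<close>.\<close>
      also have "X\<^sup>2 / d = 1 / d - 1" using X by (simp add: field_simps)
      finally show ?thesis unfolding f by (simp add: algebra_simps)
    qed
    ultimately show ?thesis by (simp add: beta_integrand_def[abs_def])
  qed
  have cont: "isCont ?f x" if "0 < x" "x < 1" for x
  proof -
    have "continuous_on {0<..<1} ?f" by (intro continuous_intros continuous_on_beta_integrand)
    then show ?thesis using that by (auto simp: continuous_on_eq_continuous_at)
  qed
  have "(LBINT x=0..1. ?f x) = 0 - 0"
  proof (rule interval_integral_FTC_integrable)
    show "((?F \<circ> real_of_ereal) \<longlongrightarrow> 0) (at_right 0)" 
      using lim0 by (simp add: zero_ereal_def ereal_tendsto_simps)
    show "((?F \<circ> real_of_ereal) \<longlongrightarrow> 0) (at_left 1)" 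
      using lim1 by (simp add: one_ereal_def ereal_tendsto_simps)
    show "set_integrable lborel (einterval 0 1) ?f" using f by (simp add: zero_ereal_def one_ereal_def)
  qed (use deriv cont in auto)
  then have "0 = (LINT x:{0<..<1}|lborel. ?f x)"
    by (simp add: zero_ereal_def one_ereal_def interval_integral_Ioo)
  also have "\<dots> = (a - 2 * b) * beta_integral (Suc n) a b + 2 * b * beta_integral (Suc n) a (b + 1)
    - of_nat (Suc n) * beta_integral n (a + 1) b"
    unfolding beta_integral_def
    by (simp only: set_integral_diff set_integral_add set_integrable_mult_right int set_integral_mult_right)
  finally show ?thesis by (simp add: algebra_simps)
qed

section \<open>The finite Gamma sum that evaluates J\<close>

text \<open>For Re a > 0 and Re b < 1 this is the binomial expansion of J(n,a,b) / Gamma(1-b), where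
  1/Gamma(1-b) cancels the Gamma(1-b) of each Beta function.\<close>

definition beta_sum :: "nat \<Rightarrow> complex \<Rightarrow> complex \<Rightarrow> complex" where
  "beta_sum n a b = (\<Sum>k\<le>n. of_nat (n choose k) * (- 1) ^ k *
     (Gamma ((a + of_nat k) / 2) * rGamma (1 + (a + of_nat k) / 2 - b))) / 2"

text \<open>Counterpart of \<open>beta_integral_rec\<close> multiplied by
  \<open>rGamma (1 - b)\<close>; since \<open>rGamma (- b) = - b * rGamma (1 - b)\<close>, the
  factor 2b there becomes -2 here.\<close>

lemma beta_sum_rec:
  "- (2 * beta_sum (Suc n) a (b + 1)) =
     (2 * b - a) * beta_sum (Suc n) a b + of_nat (Suc n) * beta_sum n (a + 1) b"
proof -
  define T where "T k = of_nat (Suc n choose k) * (- 1) ^ k *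
     (Gamma ((a + of_nat k) / 2) * rGamma (1 + (a + of_nat k) / 2 - b))" for k
  have rec: "rGamma (1 + c - (b + 1)) = (c - b) * rGamma (1 + c - b)" for c
    using rGamma_plus1[of "c - b"] by (simp add: algebra_simps)
  have "beta_sum (Suc n) a (b + 1) = (\<Sum>k\<le>Suc n. ((a + of_nat k) / 2 - b) * T k) / 2"
    unfolding beta_sum_def T_def rec by (simp only: mult_ac)
  moreover have "(b - c) * t = - ((c - b) * t)" for c t
    by (simp add: algebra_simps)
  ultimately have "- (2 * beta_sum (Suc n) a (b + 1)) = (\<Sum>k\<le>Suc n. (b - (a + of_nat k) / 2) * T k)"
    by (simp only: sum_negf) (simp del: sum.atMost_Suc)
  also have "\<dots> = (\<Sum>k\<le>Suc n. (b - a / 2) * T k - (of_nat k * T k) / 2)"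
    by (intro sum.cong refl) (simp add: add_divide_distrib algebra_simps)
  also have "\<dots> = (b - a / 2) * (\<Sum>k\<le>Suc n. T k) - (\<Sum>k\<le>Suc n. of_nat k * T k) / 2"
    by (simp only: sum_subtractf sum_distrib_left sum_divide_distrib)
  \<comment> \<open>The term for \<open>k = 0\<close> vanishes. Shifting the index raises
    \<open>a\<close> by 1, and absorbing \<open>Suc k\<close> into the binomial coefficient lowers
    its upper index to \<open>n\<close>.\<close>
  also have "(\<Sum>k\<le>Suc n. of_nat k * T k) = (\<Sum>k\<le>n. of_nat (Suc k) * T (Suc k))"
    by (subst sum.atMost_Suc_shift) simp
  also have "\<dots> = (\<Sum>k\<le>n. - of_nat (Suc n) * (of_nat (n choose k) * (- 1) ^ k *
     (Gamma ((a + 1 + of_nat k) / 2) * rGamma (1 + (a + 1 + of_nat k) / 2 - b))))"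
  proof (rule sum.cong[OF refl])
    fix k
    have "of_nat (Suc k) * of_nat (Suc n choose Suc k) = of_nat (Suc n) * (of_nat (n choose k) :: complex)"
      by (metis Suc_times_binomial of_nat_mult)
    then have "of_nat (Suc k) * T (Suc k) = of_nat (Suc n) * of_nat (n choose k) * (- 1) ^ Suc k *
       (Gamma ((a + of_nat (Suc k)) / 2) * rGamma (1 + (a + of_nat (Suc k)) / 2 - b))"
      unfolding T_def by (simp only: mult.assoc[symmetric])
    moreover have "a + of_nat (Suc k) = a + 1 + of_nat k" by simp
    ultimately show "of_nat (Suc k) * T (Suc k) = - of_nat (Suc n) * (of_nat (n choose k) * (- 1) ^ k *
     (Gamma ((a + 1 + of_nat k) / 2) * rGamma (1 + (a + 1 + of_nat k) / 2 - b)))"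
      by (simp only: power_Suc mult_ac mult_minus_left mult_minus_right mult_1_left)
  qed
  also have "\<dots> = - of_nat (Suc n) * (2 * beta_sum n (a + 1) b)"
    unfolding beta_sum_def sum_distrib_left[symmetric] by simp
  also have "(\<Sum>k\<le>Suc n. T k) = 2 * beta_sum (Suc n) a b"
    unfolding beta_sum_def T_def by simp
  also have "(b - a / 2) * (2 * beta_sum (Suc n) a b) = (2 * b - a) * beta_sum (Suc n) a b"
    by (simp add: algebra_simps)
  finally show ?thesis by (simp del: of_nat_Suc)
qed

text \<open>
  Multiplying by \<open>rGamma (1 - b)\<close> makes the identity meaningful beyond \<open>Re b < 1\<close>; the induction on
  \<open>m\<close> enlarges the range of \<open>b\<close> by one unit at a time, in place of analytic continuation.
\<close>

lemma rGamma_times_beta_integral: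
  assumes a: "Re a > 0" and b: "Re b < real n + 1"
  shows "rGamma (1 - b) * beta_integral n a b = beta_sum n a b"
proof -
  have base: "rGamma (1 - b) * beta_integral n a b = beta_sum n a b"
    if a: "Re a > 0" and b: "Re b < 1" for n a b
  proof -
    have nz: "1 - b \<notin> \<int>\<^sub>\<le>\<^sub>0" using b by (auto elim!: nonpos_Ints_cases dest!: arg_cong[where f = Re])
    then have 1: "rGamma (1 - b) * Gamma (1 - b) = 1"
      by (simp add: rGamma_inverse_Gamma Gamma_eq_zero_iff)
    have "rGamma (1 - b) * beta_integral 0 (a + of_nat k) b =
       (rGamma (1 - b) * Gamma (1 - b)) * (Gamma ((a + of_nat k) / 2) * rGamma (1 + (a + of_nat k) / 2 - b)) / 2" for k
      using a b by (subst beta_integral_0) (simp_all add: Beta_altdef algebra_simps)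
    then have "rGamma (1 - b) * beta_integral 0 (a + of_nat k) b =
       (Gamma ((a + of_nat k) / 2) * rGamma (1 + (a + of_nat k) / 2 - b)) / 2" for k
      unfolding 1 by simp
    note 2 = this
    have "rGamma (1 - b) * beta_integral n a b = (\<Sum>k\<le>n. of_nat (n choose k) * (- 1) ^ k *
         (rGamma (1 - b) * beta_integral 0 (a + of_nat k) b))"
      unfolding beta_integral_expand[OF a b] sum_distrib_left by (intro sum.cong) (simp_all add: mult_ac)
    also have "\<dots> = beta_sum n a b"
      unfolding 2 beta_sum_def sum_divide_distrib by simp
    finally show ?thesis .
  qed
  \<comment> \<open>A bound \<open>m\<close> separate from \<open>n\<close>: the recurrence lowers
    \<open>b\<close> by 1 but involves both \<open>n\<close> and its predecessor.\<close>
  have "rGamma (1 - b) * beta_integral n a b = beta_sum n a b"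
    if "Re a > 0" "Re b < real n + 1" "Re b < real m + 1" for m
    using that
  proof (induction m arbitrary: n a b)
    case 0
    then show ?case using base by simp
  next
    case (Suc m)
    show ?case
    proof (cases "Re b < 1")
      case True
      then show ?thesis using base Suc.prems by blast
    next
      case False
      \<comment> \<open>For \<open>n = 0\<close> the bound \<open>Re b < real n + 1\<close> would
        contradict \<open>Re b \<ge> 1\<close>.\<close>
      with Suc.prems obtain n' where n: "n = Suc n'" by (cases n) auto
      define c where "c = b - 1"
      have b: "b = c + 1" by (simp add: c_def)
      have c: "Re c < real n' + 1" "Re c < real m + 1" using Suc.prems by (auto simp: c_def n)
      have IH: "rGamma (1 - c) * beta_integral (Suc n') a c = beta_sum (Suc n') a c"
        "rGamma (1 - c) * beta_integral n' (a + 1) c = beta_sum n' (a + 1) c"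
        using Suc.IH[of a c "Suc n'"] Suc.IH[of "a + 1" c n'] Suc.prems c by auto
      \<comment> \<open>This supplies the factor \<open>c\<close> of the recurrence without a
        division, so \<open>c = 0\<close> is covered.\<close>
      have "rGamma (1 - b) = - c * rGamma (1 - c)"
        using rGamma_plus1[of "- c"] by (simp add: b)
      then have "- (2 * (rGamma (1 - b) * beta_integral n a b)) =
          rGamma (1 - c) * (2 * c * beta_integral (Suc n') a (c + 1))"
        by (simp add: n b)
      also have "\<dots> = (2 * c - a) * (rGamma (1 - c) * beta_integral (Suc n') a c)
          + of_nat (Suc n') * (rGamma (1 - c) * beta_integral n' (a + 1) c)"
        unfolding beta_integral_rec[OF Suc.prems(1) c(1)] by (simp only: distrib_left mult_ac)
      also have "\<dots> = - (2 * beta_sum n a b)"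
        unfolding IH beta_sum_rec[symmetric] by (simp add: n b)
      finally show ?thesis by simp
    qed
  qed
  from this[of n] assms show ?thesis by simp
qed

section \<open>Duplication formula and the coefficient identity\<close>

lemma Gamma_double_times_rGamma:
  assumes "Re c > 0"
  shows "Gamma (2 * c) * rGamma (c + 1 / 2) * of_real (sqrt pi) = 2 powr (2 * c - 1) * Gamma c"
proof -
  have nz: "c \<notin> \<int>\<^sub>\<le>\<^sub>0" "c + 1 / 2 \<notin> \<int>\<^sub>\<le>\<^sub>0"
    using assms by (auto elim!: nonpos_Ints_cases dest!: arg_cong[where f = Re])
  have "(2 :: complex) powr (2 * c - 1) * Gamma c =
      2 powr (2 * c - 1) * (Gamma c * Gamma (c + 1 / 2)) * rGamma (c + 1 / 2)"
    using nz by (simp add: rGamma_inverse_Gamma Gamma_eq_zero_iff)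
  also have "\<dots> = (2 powr (2 * c - 1) * exp ((1 - 2 * c) * of_real (ln 2))) *
      (Gamma (2 * c) * rGamma (c + 1 / 2) * of_real (sqrt pi))"
    unfolding Gamma_legendre_duplication[OF nz] by (simp add: mult_ac)
  also have "(2 :: complex) powr (2 * c - 1) * exp ((1 - 2 * c) * of_real (ln 2)) = 1"
    using of_real_powr_eq_exp[of 2 "2 * c - 1"] by (simp add: algebra_simps flip: exp_add)
  finally show ?thesis by simp
qed

text \<open>The integral coefficient equals the product coefficient. With c = (k - \<nu>)/2 and b =
  (\<mu> + n)/2, duplication reduces the k-th product term to a constant times Gamma(c)/Gamma(1 + c
  - b), as in \<open>beta_sum\<close>; the powers of 2 depending on c cancel.\<close>

lemma parabolic_D0_convolution:
  assumes "Re \<nu> < 0" "Re \<mu> < 2"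
  shows "rGamma (- \<nu>) * parabolic_D0 (\<mu> - 1 + of_nat n) * beta_integral n (- \<nu>) ((\<mu> + of_nat n) / 2) =
    (\<Sum>k\<le>n. of_nat (n choose k) * (- 1) ^ k * (pochhammer (- \<nu>) k * parabolic_D0 (\<nu> - of_nat k)
       * parabolic_D0 (\<nu> + \<mu> - 1 + of_nat (n - k))))"
proof -
  define b where "b = (\<mu> + of_nat n) / 2"
  define K where "K = 2 powr ((\<mu> - 1 + of_nat n) / 2) * of_real (sqrt pi) * rGamma (- \<nu>)"
  \<comment> \<open>\<open>Re \<mu> < 2\<close> gives Re b < n/2 + 1, which is at most n +
    1.\<close>
  have b: "Re b < real n + 1" using assms by (simp add: b_def)
  have nu: "- \<nu> \<notin> \<int>\<^sub>\<le>\<^sub>0"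
    using assms by (auto elim!: nonpos_Ints_cases dest!: arg_cong[where f = Re])
  have term_eq: "pochhammer (- \<nu>) k * parabolic_D0 (\<nu> - of_nat k) * parabolic_D0 (\<nu> + \<mu> - 1 + of_nat (n - k))
     = K * (Gamma ((- \<nu> + of_nat k) / 2) * rGamma (1 + (- \<nu> + of_nat k) / 2 - b)) / 2" if "k \<le> n" for k
  proof -
    define c where "c = (- \<nu> + of_nat k) / 2"
    have c: "Re c > 0" using assms by (simp add: c_def add_pos_nonneg)
    have 1: "pochhammer (- \<nu>) k = Gamma (2 * c) * rGamma (- \<nu>)"
    proof -
      have "2 * c = - \<nu> + of_nat k" by (simp add: c_def)
      then show ?thesis by (simp only: pochhammer_Gamma[OF nu] rGamma_inverse_Gamma divide_inverse)
    qed
    have 2: "parabolic_D0 (\<nu> - of_nat k) = 2 powr (- c) * of_real (sqrt pi) * rGamma (c + 1 / 2)"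
    proof -
      have "(\<nu> - of_nat k) / 2 = - c" "1 / 2 - (\<nu> - of_nat k) / 2 = c + 1 / 2"
        by (simp_all add: c_def field_simps)
      then show ?thesis by (simp only: parabolic_D0_def)
    qed
    have 3: "parabolic_D0 (\<nu> + \<mu> - 1 + of_nat (n - k)) =
        2 powr ((\<mu> - 1 + of_nat n) / 2 - c) * of_real (sqrt pi) * rGamma (1 + c - b)"
    proof -
      have "(\<nu> + \<mu> - 1 + of_nat (n - k)) / 2 = (\<mu> - 1 + of_nat n) / 2 - c"
        "1 / 2 - (\<nu> + \<mu> - 1 + of_nat (n - k)) / 2 = 1 + c - b"
        using that by (simp_all add: c_def b_def of_nat_diff field_simps)
      then show ?thesis by (simp only: parabolic_D0_def)
    qed
    have "pochhammer (- \<nu>) k * parabolic_D0 (\<nu> - of_nat k) * parabolic_D0 (\<nu> + \<mu> - 1 + of_nat (n - k))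
      = (2 powr (- c) * 2 powr ((\<mu> - 1 + of_nat n) / 2 - c)) * of_real (sqrt pi) * rGamma (- \<nu>) *
        (Gamma (2 * c) * rGamma (c + 1 / 2) * of_real (sqrt pi)) * rGamma (1 + c - b)"
      unfolding 1 2 3 by (simp only: mult_ac)
    also have "\<dots> = (2 powr (- c) * 2 powr ((\<mu> - 1 + of_nat n) / 2 - c) * 2 powr (2 * c - 1))
       * of_real (sqrt pi) * rGamma (- \<nu>) * (Gamma c * rGamma (1 + c - b))"
      unfolding Gamma_double_times_rGamma[OF c] by (simp only: mult_ac)
    also have "2 powr (- c) * 2 powr ((\<mu> - 1 + of_nat n) / 2 - c) * 2 powr (2 * c - 1)
       = (2 :: complex) powr ((\<mu> - 1 + of_nat n) / 2 - 1)"
      unfolding powr_add[symmetric] by (simp add: algebra_simps)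
    also have "\<dots> = 2 powr ((\<mu> - 1 + of_nat n) / 2) / 2"
      by (simp add: powr_diff)
    finally show ?thesis unfolding K_def c_def by simp
  qed
  \<comment> \<open>So d(\<mu> - 1 + n) itself contains the factor \<open>rGamma (1 - b)\<close>
    that the evaluation of J requires.\<close>
  have "1 / 2 - (\<mu> - 1 + of_nat n) / 2 = 1 - b" by (simp add: b_def field_simps)
  then have "rGamma (- \<nu>) * parabolic_D0 (\<mu> - 1 + of_nat n) * beta_integral n (- \<nu>) b =
      K * (rGamma (1 - b) * beta_integral n (- \<nu>) b)"
    unfolding parabolic_D0_def K_def by simp
  also have "\<dots> = K * beta_sum n (- \<nu>) b"
    using rGamma_times_beta_integral[of "- \<nu>" b n] assms b by simp
  also have "\<dots> = (\<Sum>k\<le>n. of_nat (n choose k) * (- 1) ^ k *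
      (K * (Gamma ((- \<nu> + of_nat k) / 2) * rGamma (1 + (- \<nu> + of_nat k) / 2 - b)) / 2))"
    unfolding beta_sum_def sum_divide_distrib sum_distrib_left by (intro sum.cong) (simp_all add: mult_ac)
  also have "\<dots> = (\<Sum>k\<le>n. of_nat (n choose k) * (- 1) ^ k * (pochhammer (- \<nu>) k * parabolic_D0 (\<nu> - of_nat k)
       * parabolic_D0 (\<nu> + \<mu> - 1 + of_nat (n - k))))"
    by (intro sum.cong) (simp_all only: term_eq atMost_iff)
  finally show ?thesis unfolding b_def .
qed

subsection \<open>Comparison of Taylor coefficients\<close>

text \<open>Cauchy product of the two Taylor series, taken at \<open>- z\<close> and at
  \<open>z\<close>; their weights \<open>exp (z\<^sup>2 / 4)\<close> and
  \<open>exp (- (z\<^sup>2 / 4))\<close> cancel.\<close>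

lemma parabolic_D_product_sums:
  "(\<lambda>n. (- z) ^ n / fact n * (\<Sum>k\<le>n. of_nat (n choose k) * (- 1) ^ k *
      (pochhammer (- \<nu>) k * parabolic_D0 (\<nu> - of_nat k) * parabolic_D0 (\<rho> + of_nat (n - k)))))
    sums (parabolic_D \<nu> (- z) * parabolic_D \<rho> z)"
proof -
  let ?f = "\<lambda>n. (- (- z)) ^ n / fact n * (pochhammer (- \<nu>) n * parabolic_D0 (\<nu> - of_nat n))"
  let ?g = "\<lambda>n. (- z) ^ n / fact n * parabolic_D0 (\<rho> + of_nat n)"
  have f: "?f sums (exp ((- z)\<^sup>2 / 4) * parabolic_D \<nu> (- z))"
    by (rule parabolic_D_exp_pos_sums)
  have g: "?g sums (exp (- (z\<^sup>2 / 4)) * parabolic_D \<rho> z)"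
    by (rule parabolic_D_exp_neg_sums)
  have nf: "summable (\<lambda>n. norm (?f n))"
  proof -
    have "summable (\<lambda>n. (pochhammer (- \<nu>) n * parabolic_D0 (\<nu> - of_nat n) / fact n) * w ^ n)" for w
      using sums_summable[OF parabolic_D_exp_pos_sums[of "- w" \<nu>]] by (simp add: mult_ac)
    from summable_norm_powser[OF this, of z] show ?thesis by (simp add: mult_ac)
  qed
  have ng: "summable (\<lambda>n. norm (?g n))"
  proof -
    have "summable (\<lambda>n. (parabolic_D0 (\<rho> + of_nat n) / fact n) * w ^ n)" for w
      using sums_summable[OF parabolic_D_exp_neg_sums[of "- w" \<rho>]] by (simp add: mult_ac)
    from summable_norm_powser[OF this, of "- z"] show ?thesis by (simp add: mult_ac)
  qed
  have "(\<lambda>n. \<Sum>k\<le>n. ?f k * ?g (n - k)) sums ((\<Sum>n. ?f n) * (\<Sum>n. ?g n))"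
    using nf ng by (rule Cauchy_product_sums)
  also have "(\<Sum>n. ?f n) * (\<Sum>n. ?g n) = parabolic_D \<nu> (- z) * parabolic_D \<rho> z"
    unfolding sums_unique[OF f, symmetric] sums_unique[OF g, symmetric] by (simp add: exp_minus)
  also have "(\<lambda>n. \<Sum>k\<le>n. ?f k * ?g (n - k)) = (\<lambda>n. (- z) ^ n / fact n * (\<Sum>k\<le>n. of_nat (n choose k) * (- 1) ^ k *
      (pochhammer (- \<nu>) k * parabolic_D0 (\<nu> - of_nat k) * parabolic_D0 (\<rho> + of_nat (n - k)))))"
  proof
    fix n
    have "?f k * ?g (n - k) = (- z) ^ n / fact n * (of_nat (n choose k) * (- 1) ^ k *
      (pochhammer (- \<nu>) k * parabolic_D0 (\<nu> - of_nat k) * parabolic_D0 (\<rho> + of_nat (n - k))))" if "k \<le> n" for k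
    proof -
      have 1: "(- (- z)) ^ k * (- z) ^ (n - k) = (- z) ^ n * (- 1) ^ k"
      proof -
        have "(- z) ^ n = (- z) ^ k * (- z) ^ (n - k)" using that by (simp flip: power_add)
        then show ?thesis unfolding power_minus[of "- z" k] by (simp only: mult_ac)
      qed
      have 2: "of_nat (n choose k) / fact n = 1 / (fact k * fact (n - k) :: complex)"
        using that by (simp add: binomial_fact)
      have "?f k * ?g (n - k) = ((- (- z)) ^ k * (- z) ^ (n - k)) * (1 / (fact k * fact (n - k))) *
          (pochhammer (- \<nu>) k * parabolic_D0 (\<nu> - of_nat k) * parabolic_D0 (\<rho> + of_nat (n - k)))"
        by simp
      also have "\<dots> = ((- z) ^ n * (- 1) ^ k) * (of_nat (n choose k) / fact n) *
          (pochhammer (- \<nu>) k * parabolic_D0 (\<nu> - of_nat k) * parabolic_D0 (\<rho> + of_nat (n - k)))"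
        unfolding 1 2 ..
      finally show ?thesis by (simp add: mult_ac)
    qed
    then show "(\<Sum>k\<le>n. ?f k * ?g (n - k)) = (- z) ^ n / fact n * (\<Sum>k\<le>n. of_nat (n choose k) * (- 1) ^ k *
      (pochhammer (- \<nu>) k * parabolic_D0 (\<nu> - of_nat k) * parabolic_D0 (\<rho> + of_nat (n - k))))"
      unfolding sum_distrib_left by (intro sum.cong) (simp_all only: atMost_iff)
  qed
  finally show ?thesis .
qed

section \<open>Moments of the hyperbolic weight\<close>

text \<open>With x = exp (-2t) one has sinh 2t = (1-x^2)/(2x), and the powers x^(\<mu>/2) cancel.
  The Jacobian 2x leaves the exponent -\<nu> - 1 of x and the constant 2^(\<mu>/2-1).\<close>

lemma hyperbolic_weight_eq:
  assumes t: "t > 0"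
  shows "exp ((2 * \<nu> + \<mu>) * of_real t) / of_real (sinh (2 * t)) powr (\<mu> / 2) * of_real (sqrt (tanh t) ^ n) =
    2 powr (\<mu> / 2 - 1) * (\<bar>- 2 * exp (- 2 * t)\<bar> *\<^sub>R beta_integrand n (- \<nu>) ((\<mu> + of_nat n) / 2) (exp (- 2 * t)))"
proof -
  define x where "x = exp (- 2 * t)"
  define L where "L = ln (1 - x\<^sup>2)"
  have x: "0 < x" "x < 1" using t by (auto simp: x_def)
  have pos: "0 < 1 - x\<^sup>2" using one_minus_square_pos x by blast
  have et: "exp (2 * t) = 1 / x" unfolding x_def by (simp add: exp_minus divide_inverse)
  have "sinh (2 * t) = (1 - x\<^sup>2) / (2 * x)"
    using x unfolding sinh_field_def et exp_minus[of "2 * t"] by (simp add: field_simps power2_eq_square)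
  then have lnsinh: "ln (sinh (2 * t)) = 2 * t + L - ln 2"
    using x pos by (simp add: ln_div ln_mult L_def x_def)
  have "(tanh t) = (1 - x) / (1 + x)"
    using tanh_real_altdef[of t] by (simp add: x_def)
  \<comment> \<open>With a square in the numerator, the n-th power of the root is (1-x)^n
    (1-x^2)^(-n/2), which adds n/2 to the parameter \<open>b\<close>.\<close>
  also have "\<dots> = (1 - x)\<^sup>2 / (1 - x\<^sup>2)"
  proof -
    have "1 - x\<^sup>2 = (1 - x) * (1 + x)" by (simp add: algebra_simps power2_eq_square)
    then show ?thesis using x by (simp add: power2_eq_square)
  qed
  finally have "sqrt (tanh t) = (1 - x) / sqrt (1 - x\<^sup>2)"
    using x by (simp add: real_sqrt_divide)
  also have "sqrt (1 - x\<^sup>2) = exp (L / 2)"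
    using pos unfolding L_def powr_half_sqrt[OF less_imp_le[OF pos], symmetric] powr_def by simp
  finally have "sqrt (tanh t) = (1 - x) * exp (- (L / 2))" by (simp add: exp_minus field_simps)
  then have "sqrt (tanh t) ^ n = (1 - x) ^ n * exp (- (real n * L / 2))"
    by (simp add: power_mult_distrib flip: exp_of_nat_mult)
  then have T: "complex_of_real (sqrt (tanh t) ^ n) = exp (- (of_nat n * of_real L / 2)) * of_real ((1 - x) ^ n)"
  proof -
    have "- (of_nat n * of_real L / 2) = complex_of_real (- (real n * L / 2))" by simp
    then show ?thesis using \<open>sqrt (tanh t) ^ n = _\<close> by (simp only: exp_of_real of_real_mult mult.commute)
  qed
  have S: "of_real (sinh (2 * t)) powr (\<mu> / 2) = exp (\<mu> / 2 * (2 * of_real t + of_real L - of_real (ln 2)))"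
    using t lnsinh by (simp add: of_real_powr_eq_exp)
  have two: "2 powr (\<mu> / 2 - 1) * of_real 2 = exp (\<mu> / 2 * of_real (ln 2))"
    using of_real_powr_eq_exp[of 2 "\<mu> / 2"] by (simp add: powr_diff)
  have "exp ((2 * \<nu> + \<mu>) * of_real t) / of_real (sinh (2 * t)) powr (\<mu> / 2) * of_real (sqrt (tanh t) ^ n)
     = exp ((2 * \<nu> + \<mu>) * of_real t - \<mu> / 2 * (2 * of_real t + of_real L - of_real (ln 2)) +
         - (of_nat n * of_real L / 2)) * of_real ((1 - x) ^ n)"
    unfolding T S exp_add exp_diff by simp
  also have "(2 * \<nu> + \<mu>) * of_real t - \<mu> / 2 * (2 * of_real t + of_real L - of_real (ln 2)) +
         - (of_nat n * of_real L / 2) =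
      \<mu> / 2 * of_real (ln 2) + (of_real (- 2 * t) + ((- \<nu> - 1) * of_real (- 2 * t) - (\<mu> + of_nat n) / 2 * of_real L))"
    by (simp add: field_simps)
  also have "exp \<dots> * of_real ((1 - x) ^ n) =
      exp (\<mu> / 2 * of_real (ln 2)) * (of_real x * beta_integrand n (- \<nu>) ((\<mu> + of_nat n) / 2) x)"
  proof -
    have "exp (of_real (- 2 * t)) = complex_of_real x" by (simp only: x_def exp_of_real)
    moreover have "ln x = - 2 * t" by (simp add: x_def)
    ultimately show ?thesis
      by (simp only: exp_add beta_integrand_def L_def[symmetric] mult_ac)
  qed
  also have "\<dots> = 2 powr (\<mu> / 2 - 1) * (\<bar>- 2 * x\<bar> *\<^sub>R beta_integrand n (- \<nu>) ((\<mu> + of_nat n) / 2) x)"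
    unfolding two[symmetric] using x by (simp add: scaleR_conv_of_real)
  finally show ?thesis unfolding x_def .
qed

text \<open>The hypotheses make J convergent for every \<open>n\<close>: Re a = -Re \<nu> > 0 and Re
  (\<mu> + n)/2 < n + 1.\<close>

lemma hyperbolic_weight_integral:
  assumes "Re \<mu> < 2" "Re \<nu> < 0"
  defines "w \<equiv> \<lambda>n t. exp ((2 * \<nu> + \<mu>) * of_real t) / of_real (sinh (2 * t)) powr (\<mu> / 2) * of_real (sqrt (tanh t) ^ n)"
  shows "set_integrable lborel {0<..} (w n)"
    "(LINT t:{0<..}|lborel. w n t) = 2 powr (\<mu> / 2 - 1) * beta_integral n (- \<nu>) ((\<mu> + of_nat n) / 2)"
proof -
  let ?b = "beta_integrand n (- \<nu>) ((\<mu> + of_nat n) / 2)"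
  let ?h = "\<lambda>t. \<bar>- 2 * exp (- 2 * t)\<bar> *\<^sub>R ?b (exp (- 2 * t))"
  have img: "(\<lambda>t. exp (- 2 * t)) ` {0<..} = {0<..<1 :: real}"
  proof safe
    fix x :: real assume "x \<in> {0<..<1}"
    then show "x \<in> (\<lambda>t. exp (- 2 * t)) ` {0<..}"
      by (intro image_eqI[of _ _ "- ln x / 2"]) auto
  qed auto
  have int: "set_integrable lborel {0<..<1} ?b"
    using assms by (intro set_integrable_beta_integrand) auto
  have sub: "set_integrable lborel {0<..} ?h \<longleftrightarrow> set_integrable lborel ((\<lambda>t. exp (- 2 * t)) ` {0<..}) ?b"
    "(LINT t:{0<..}|lborel. ?h t) = (LINT x:(\<lambda>t. exp (- 2 * t)) ` {0<..}|lborel. ?b x)"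
  proof -
    let ?g = "\<lambda>t :: real. exp (- 2 * t)"
    have d: "(?g has_field_derivative - 2 * exp (- 2 * t)) (at t)" for t
      by (auto intro!: derivative_eq_intros)
    have "inj_on ?g {0<..}" "continuous_on {0<..} (\<lambda>t :: real. - 2 * exp (- 2 * t))"
      by (auto intro!: inj_onI continuous_intros)
    moreover have "open (?g ` {0<..})" "continuous_on (?g ` {0<..}) ?b"
      unfolding img by (simp_all add: continuous_on_beta_integrand)
    ultimately show "set_integrable lborel {0<..} ?h \<longleftrightarrow> set_integrable lborel (?g ` {0<..}) ?b"
      "(LINT t:{0<..}|lborel. ?h t) = (LINT x:?g ` {0<..}|lborel. ?b x)"
      using d by (intro set_lborel_integral_substitution; simp)+
  qed
  have w: "w n t = 2 powr (\<mu> / 2 - 1) * ?h t" if "t \<in> {0<..}" for t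
    using that hyperbolic_weight_eq[of t] unfolding w_def by simp
  have "set_integrable lborel {0<..} (\<lambda>t. 2 powr (\<mu> / 2 - 1) * ?h t)"
    using sub(1) int unfolding img by (intro set_integrable_mult_right) simp
  then show "set_integrable lborel {0<..} (w n)"
    by (subst set_integrable_cong[OF refl refl w]) auto
  have "(LINT t:{0<..}|lborel. w n t) = (LINT t:{0<..}|lborel. 2 powr (\<mu> / 2 - 1) * ?h t)"
    by (rule set_lebesgue_integral_cong) (auto simp: w)
  also have "\<dots> = 2 powr (\<mu> / 2 - 1) * beta_integral n (- \<nu>) ((\<mu> + of_nat n) / 2)"
    unfolding set_integral_mult_right sub(2) img beta_integral_def ..
  finally show "(LINT t:{0<..}|lborel. w n t) = 2 powr (\<mu> / 2 - 1) * beta_integral n (- \<nu>) ((\<mu> + of_nat n) / 2)" .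
qed

theorem corollary2:
  fixes \<mu> \<nu> z :: complex
  defines "f \<equiv> \<lambda>t::real.
    exp ((2 * \<nu> + \<mu>) * of_real t - z\<^sup>2 / 4 * of_real (tanh t))
      * parabolic_D (\<mu> - 1) (z * of_real (sqrt (tanh t)))
      / of_real (sinh (2 * t)) powr (\<mu> / 2)"
  assumes "Re \<mu> < 2" and "Re \<nu> < 0"
  shows "set_integrable lborel {0<..} f \<and>
    parabolic_D \<nu> (- z) * parabolic_D (\<nu> + \<mu> - 1) z =
      2 powr (1 - \<mu> / 2) / Gamma (- \<nu>) * (LINT t:{0<..}|lborel. f t)"
proof -
  define w where "w n t = exp ((2 * \<nu> + \<mu>) * of_real t) / of_real (sinh (2 * t)) powr (\<mu> / 2)
    * of_real (sqrt (tanh t) ^ n)" for n and t :: real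
  \<comment> \<open>The part free of t in the series of exp (-s^2/4) D(s), with index \<mu> - 1, at
    s = z sqrt (tanh t). The exponential of that series is the factor exp (- z^2/4 tanh t) of the
    integrand.\<close>
  define c where "c n = (- z) ^ n / fact n * parabolic_D0 (\<mu> - 1 + of_nat n)" for n
  let ?F = "\<lambda>n t. indicator {0<..} t *\<^sub>R (c n * w n t)"
  note wint = hyperbolic_weight_integral[OF assms(2,3), folded w_def]
  have sumc: "summable (\<lambda>n. norm (c n))"
  proof -
    have "summable (\<lambda>n. (parabolic_D0 (\<mu> - 1 + of_nat n) / fact n) * x ^ n)" for x
      using sums_summable[OF parabolic_D_exp_neg_sums[of "- x" "\<mu> - 1"]] by (simp add: mult_ac)
    from summable_norm_powser[OF this, of "- z"] show ?thesis by (simp add: c_def mult_ac)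
  qed
  have sums_f: "(\<lambda>n. ?F n t) sums (indicator {0<..} t *\<^sub>R f t)" for t
  proof (cases "t > 0")
    case True
    then have T: "tanh t > 0" by simp
    have "(\<lambda>n. w 0 t * ((- (z * of_real (sqrt (tanh t)))) ^ n / fact n * parabolic_D0 (\<mu> - 1 + of_nat n))) sums
      (w 0 t * (exp (- ((z * of_real (sqrt (tanh t)))\<^sup>2 / 4)) * parabolic_D (\<mu> - 1) (z * of_real (sqrt (tanh t)))))"
      by (intro sums_mult parabolic_D_exp_neg_sums)
    also have "(\<lambda>n. w 0 t * ((- (z * of_real (sqrt (tanh t)))) ^ n / fact n * parabolic_D0 (\<mu> - 1 + of_nat n)))
       = (\<lambda>n. c n * w n t)"
      unfolding w_def c_def mult_minus_left[symmetric] power_mult_distrib by (simp add: mult_ac)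
    also have "(z * of_real (sqrt (tanh t)))\<^sup>2 / 4 = z\<^sup>2 / 4 * of_real (tanh t)"
      using T by (simp add: power_mult_distrib flip: of_real_power)
    also have "w 0 t * (exp (- (z\<^sup>2 / 4 * of_real (tanh t))) * parabolic_D (\<mu> - 1) (z * of_real (sqrt (tanh t)))) = f t"
      unfolding f_def w_def exp_diff exp_minus divide_inverse
      by (simp only: power_0 of_real_1 mult_1_left mult_1_right mult_ac)
    finally show ?thesis using True by simp
  qed simp
  have F_int: "integrable lborel (?F n)" for n
    using set_integrable_mult_right[OF wint(1), of "c n" n] unfolding set_integrable_def by simp
  \<comment> \<open>Since 0 < tanh t < 1, all weights are dominated by \<open>w 0\<close>; with the
    summability of \<open>norm (c n)\<close> this justifies interchanging sum and integral.\<close>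
  have F_le: "norm (?F n t) \<le> norm (c n) * norm (indicator {0<..} t *\<^sub>R w 0 t)" for n t
  proof (cases "t > 0")
    case True
    then have "0 < tanh t" "tanh t < 1" by (auto simp: tanh_real_lt_1)
    then have "sqrt (tanh t) ^ n \<le> 1" "0 \<le> sqrt (tanh t) ^ n" by (auto intro!: power_le_one)
    then have "norm (w n t) \<le> norm (w 0 t)"
      unfolding w_def norm_mult by (intro mult_left_mono) (auto simp del: of_real_power)
    then show ?thesis using True by (simp add: norm_mult mult_left_mono)
  qed simp
  have w0: "integrable lborel (\<lambda>t. norm (indicator {0<..} t *\<^sub>R w 0 t))"
    using wint(1)[of 0] unfolding set_integrable_def by (rule integrable_norm)
  have AE: "AE t in lborel. summable (\<lambda>n. norm (?F n t))"
  proof (rule AE_I2)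
    fix t
    show "summable (\<lambda>n. norm (?F n t))"
      by (rule summable_comparison_test'[OF summable_mult2[OF sumc, of "norm (indicator {0<..} t *\<^sub>R w 0 t)"]])
        (simp only: F_le real_norm_def abs_norm_cancel)
  qed
  have sum_int: "summable (\<lambda>n. LINT t|lborel. norm (?F n t))"
  proof (rule summable_comparison_test'[OF summable_mult2[OF sumc, of "LINT t|lborel. norm (indicator {0<..} t *\<^sub>R w 0 t)"]])
    fix n
    have "(LINT t|lborel. norm (?F n t)) \<le> (LINT t|lborel. norm (c n) * norm (indicator {0<..} t *\<^sub>R w 0 t))"
      by (intro integral_mono F_le integrable_norm F_int integrable_mult_right w0)
    then show "norm (LINT t|lborel. norm (?F n t)) \<le> norm (c n) * (LINT t|lborel. norm (indicator {0<..} t *\<^sub>R w 0 t))"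
      by simp
  qed
  have suminf: "(\<lambda>t. \<Sum>n. ?F n t) = (\<lambda>t. indicator {0<..} t *\<^sub>R f t)"
    using sums_f by (simp add: sums_iff fun_eq_iff)
  have int_f: "set_integrable lborel {0<..} f"
    using integrable_suminf[OF F_int AE sum_int] unfolding suminf set_integrable_def .
  have "(\<lambda>n. LINT t|lborel. ?F n t) sums (LINT t:{0<..}|lborel. f t)"
    using sums_integral[OF F_int AE sum_int] unfolding suminf set_lebesgue_integral_def .
  moreover have "(LINT t|lborel. ?F n t) = c n * (2 powr (\<mu> / 2 - 1) * beta_integral n (- \<nu>) ((\<mu> + of_nat n) / 2))" for n
    using set_integral_mult_right[of lborel "{0<..}" "c n" "w n"] wint(2)[of n]
    unfolding set_lebesgue_integral_def by simp
  ultimately have "(\<lambda>n. c n * (2 powr (\<mu> / 2 - 1) * beta_integral n (- \<nu>) ((\<mu> + of_nat n) / 2))) sums (LINT t:{0<..}|lborel. f t)"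
    by simp
  then have "(\<lambda>n. 2 powr (1 - \<mu> / 2) * rGamma (- \<nu>) * (c n * (2 powr (\<mu> / 2 - 1) * beta_integral n (- \<nu>) ((\<mu> + of_nat n) / 2))))
    sums (2 powr (1 - \<mu> / 2) * rGamma (- \<nu>) * (LINT t:{0<..}|lborel. f t))"
    by (rule sums_mult)
  also have "(\<lambda>n. 2 powr (1 - \<mu> / 2) * rGamma (- \<nu>) * (c n * (2 powr (\<mu> / 2 - 1) * beta_integral n (- \<nu>) ((\<mu> + of_nat n) / 2)))) =
    (\<lambda>n. (- z) ^ n / fact n * (\<Sum>k\<le>n. of_nat (n choose k) * (- 1) ^ k *
      (pochhammer (- \<nu>) k * parabolic_D0 (\<nu> - of_nat k) * parabolic_D0 (\<nu> + \<mu> - 1 + of_nat (n - k)))))"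
  proof
    fix n
    have "2 powr (1 - \<mu> / 2) * rGamma (- \<nu>) * (c n * (2 powr (\<mu> / 2 - 1) * beta_integral n (- \<nu>) ((\<mu> + of_nat n) / 2)))
      = (2 powr (1 - \<mu> / 2) * 2 powr (\<mu> / 2 - 1)) * ((- z) ^ n / fact n *
         (rGamma (- \<nu>) * parabolic_D0 (\<mu> - 1 + of_nat n) * beta_integral n (- \<nu>) ((\<mu> + of_nat n) / 2)))"
      unfolding c_def by (simp only: mult_ac)
    \<comment> \<open>The prefactor in the theorem cancels the constant produced by the
      substitution, leaving exactly the coefficient identity.\<close>
    also have "2 powr (1 - \<mu> / 2) * 2 powr (\<mu> / 2 - 1) = (1 :: complex)"
      unfolding powr_add[symmetric] by simp
    finally show "2 powr (1 - \<mu> / 2) * rGamma (- \<nu>) * (c n * (2 powr (\<mu> / 2 - 1) * beta_integral n (- \<nu>) ((\<mu> + of_nat n) / 2)))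
      = (- z) ^ n / fact n * (\<Sum>k\<le>n. of_nat (n choose k) * (- 1) ^ k *
      (pochhammer (- \<nu>) k * parabolic_D0 (\<nu> - of_nat k) * parabolic_D0 (\<nu> + \<mu> - 1 + of_nat (n - k))))"
      unfolding parabolic_D0_convolution[OF assms(3,2)] by simp
  qed
  finally have "2 powr (1 - \<mu> / 2) * rGamma (- \<nu>) * (LINT t:{0<..}|lborel. f t) =
      parabolic_D \<nu> (- z) * parabolic_D (\<nu> + \<mu> - 1) z"
    using parabolic_D_product_sums sums_unique2 by blast
  moreover have "2 powr (1 - \<mu> / 2) / Gamma (- \<nu>) = 2 powr (1 - \<mu> / 2) * rGamma (- \<nu>)"
    by (simp only: rGamma_inverse_Gamma divide_inverse)
  ultimately show ?thesis using int_f by (simp only: simp_thms)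
qed

end
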